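(* Let $\beta_0,\beta_1\in\mathbb{R}$ and let $X,Y,U$ be real random variables with $Y\mid X\sim Po(\exp(\beta_0+\beta_1X))$. Let $W=X+U$ and assume that $U$ is independent of $(X,Y)$. Let $(Y_i,X_i,U_i)$, $i=1,\dots,n$, be i.i.d. samples of $(Y,X,U)$, let $W_i=X_i+U_i$, let $\hat{\boldsymbol\beta}^{(N)}=(\hat\beta_0^{(N)},\hat\beta_1^{(N)})'$ be the naïve estimator based on $(Y_i,W_i)_{i=1}^n$, and let $\boldsymbol b=(b_0,b_1)'$ be its limit in probability, i.e. the solution of the limiting estimating equation (both as defined in the context). Assume that $M_X(\beta_1)$, $M_X(b_1)$, $M_U(b_1)$ exist. Let $$G(\beta_1,b_1):=K_W'(b_1)-\mathbf{E}[U]-K_X'(\beta_1).$$ Assume that $G$ has a zero in $\mathbb{R}^2$ and satisfies $$\frac{\partial G(\beta_1,b_1)}{\partial b_1}=K_W''(b_1)\neq 0.$$ Then the asymptotic biases of the naïve estimators $\hat\beta_0^{(N)}$ and $\hat\beta_1^{(N)}$ are given by $$\lim_{n\to\infty}\mathbf{E}[\hat\beta_0^{(N)}-\beta_0]=\log\left(\frac{M_X(\beta_1)}{M_W(g(\beta_1))}\right),\qquad \lim_{n\to\infty}\mathbf{E}[\hat\beta_1^{(N)}-\beta_1]=g(\beta_1)-\beta_1$$ respectively, where $g$ is a $C^1$-class function satisfying $b_1=g(\beta_1)$ in the neighborhood of the zero of $G$. Furthermore, the asymptotic mean squared errors of $\hat\beta_0^{(N)}$ and $\hat\beta_1^{(N)}$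 are given by their squared asymptotic biases: $$\lim_{n\to\infty}\mathbf{E}[(\hat\beta_0^{(N)}-\beta_0)^2]=\left(\log\left(\frac{M_X(\beta_1)}{M_W(g(\beta_1))}\right)\right)^2,\qquad \lim_{n\to\infty}\mathbf{E}[(\hat\beta_1^{(N)}-\beta_1)^2]=(g(\beta_1)-\beta_1)^2 .$$
   Context: $Po(\mu)$ is the Poisson distribution with mean $\mu$. For a random variable $Z$, $M_Z(t)=\mathbf{E}[e^{tZ}]$ is its moment generating function and $K_Z(t)=\log M_Z(t)$ its cumulant generating function; primes on $K_Z$ denote derivatives, while a prime on a vector denotes transpose. "Existence" of $M_Z(t)$ means that the expectation exists (is finite); it is assumed in order that the expectations $\mathbf{E}[Y]$, $\mathbf{E}[YW]$, $\mathbf{E}[\exp(b_0+b_1W)]$, $\mathbf{E}[W\exp(b_0+b_1W)]$ exist. Only $Y_i$ and $W_i$ are observed; $X_i$ (explanatory variable) and $U_i$ (measurement error) are not. The mean and variance of $U$ are assumed known. The naïve estimator $\hat{\boldsymbol\beta}^{(N)}=(\hat\beta_0^{(N)},\hat\beta_1^{(N)})'$ of $\boldsymbol\beta=(\beta_0,\beta_1)'$ is the solution of $$\frac1n\sum_{i=1}^n\{Y_i-\exp(\hat\beta_0^{(N)}+\hat\beta_1^{(N)}W_i)\}(1,W_i)'=(0,0)'.$$ The vector $\boldsymbol b=(b_0,b_1)'$ to which the naïve estimator converges in probability as $n\to\infty$ is the solution of $$\mathbf{E}[\{Y-\exp(b_0+b_1W)\}(1,W)']=(0,0)'.$$ The asymptotic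 bias of an estimator $\hat\theta$ (based on sample size $n$) of $\theta$ is $\lim_{n\to\infty}\mathbf{E}[\hat\theta-\theta]$, and its asymptotic mean squared error is $\lim_{n\to\infty}\mathbf{E}[(\hat\theta-\theta)^2]$. In the definition of $G$ and in $b_1=g(\beta_1)$, the symbols $\beta_1,b_1$ are also used as the variables of $G$; the function $g$ is the implicit function determined by $G(\beta_1,g(\beta_1))=0$ near the zero of $G$.
   Formalization: The squares of both naïve estimators are additionally assumed asymptotically uniformly integrable (else their expectations can be infinite, e.g. Gaussian X, U), and the estimating equation, not always solvable, need only be solved with probability tending to 1. *)

theory Defs
  imports "HOL-Probability.Probability"
begin

(* Where exp (t * Z) is not integrable, mgf M Z t is the default value 0; mgf_domain is the set of
   arguments at which the moment generating function exists. *)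

definition mgf :: "'a measure \<Rightarrow> ('a \<Rightarrow> real) \<Rightarrow> real \<Rightarrow> real" where
  "mgf M Z t = (\<integral>\<omega>. exp (t * Z \<omega>) \<partial>M)"

definition mgf_domain :: "'a measure \<Rightarrow> ('a \<Rightarrow> real) \<Rightarrow> real set" where
  "mgf_domain M Z = {t. integrable M (\<lambda>\<omega>. exp (t * Z \<omega>))}"

definition cgf :: "'a measure \<Rightarrow> ('a \<Rightarrow> real) \<Rightarrow> real \<Rightarrow> real" where
  "cgf M Z t = ln (mgf M Z t)"

(* Y | X ~ Po(exp(beta0 + beta1 X)): the Poisson law is a regular conditional distribution of the
   real-valued Y given the sigma-algebra generated by X. *)

definition poisson_regression ::
    "'a measure \<Rightarrow> real \<Rightarrow> real \<Rightarrow> ('a \<Rightarrow> real) \<Rightarrow> ('a \<Rightarrow> real) \<Rightarrow> bool" where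
  "poisson_regression M \<beta>0 \<beta>1 X Y \<longleftrightarrow>
     (\<forall>B\<in>sets borel. AE \<omega> in M.
        real_cond_exp M (vimage_algebra (space M) X borel) (indicator (Y -` B \<inter> space M)) \<omega>
        = measure (poisson_pmf (exp (\<beta>0 + \<beta>1 * X \<omega>))) (real -` B))"

(* Observations are numbered from 1. *)

definition iid_copies ::
    "'a measure \<Rightarrow> 'b measure \<Rightarrow> ('a \<Rightarrow> 'b) \<Rightarrow> (nat \<Rightarrow> 'a \<Rightarrow> 'b) \<Rightarrow> bool" where
  "iid_copies M N Z Zs \<longleftrightarrow>
     prob_space.indep_vars M (\<lambda>_. N) Zs {1..} \<and> (\<forall>i\<ge>1. distr M N (Zs i) = distr M N Z)"

definition naive_equation :: "nat \<Rightarrow> (nat \<Rightarrow> real) \<Rightarrow> (nat \<Rightarrow> real) \<Rightarrow> real \<Rightarrow> real \<Rightarrow> bool" where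
  "naive_equation n y w c0 c1 \<longleftrightarrow>
     (1 / real n) * (\<Sum>i=1..n. y i - exp (c0 + c1 * w i)) = 0 \<and>
     (1 / real n) * (\<Sum>i=1..n. (y i - exp (c0 + c1 * w i)) * w i) = 0"

(* For every n there is positive probability that naive_equation has no solution (for instance when
   all responses vanish), so that "the solution" has to be completed to a random variable there.
   Any completion is allowed: only the probability of solving the equation has to tend to 1. *)

definition naive_estimator ::
    "'a measure \<Rightarrow> (nat \<Rightarrow> 'a \<Rightarrow> real) \<Rightarrow> (nat \<Rightarrow> 'a \<Rightarrow> real) \<Rightarrow>
     (nat \<Rightarrow> 'a \<Rightarrow> real) \<Rightarrow> (nat \<Rightarrow> 'a \<Rightarrow> real) \<Rightarrow> bool" where
  "naive_estimator M Ys Ws B0 B1 \<longleftrightarrow>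
     (\<forall>n. B0 n \<in> borel_measurable M \<and> B1 n \<in> borel_measurable M) \<and>
     (\<lambda>n. measure M {\<omega> \<in> space M.
        naive_equation n (\<lambda>i. Ys i \<omega>) (\<lambda>i. Ws i \<omega>) (B0 n \<omega>) (B1 n \<omega>)}) \<longlonglongrightarrow> 1"

definition limiting_equation ::
    "'a measure \<Rightarrow> ('a \<Rightarrow> real) \<Rightarrow> ('a \<Rightarrow> real) \<Rightarrow> real \<Rightarrow> real \<Rightarrow> bool" where
  "limiting_equation M Y W b0 b1 \<longleftrightarrow>
     (\<integral>\<omega>. (Y \<omega> - exp (b0 + b1 * W \<omega>)) \<partial>M) = 0 \<and>
     (\<integral>\<omega>. (Y \<omega> - exp (b0 + b1 * W \<omega>)) * W \<omega> \<partial>M) = 0"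

definition converges_in_prob :: "'a measure \<Rightarrow> (nat \<Rightarrow> 'a \<Rightarrow> real) \<Rightarrow> real \<Rightarrow> bool" where
  "converges_in_prob M Z c \<longleftrightarrow>
     (\<forall>e>0. (\<lambda>n. measure M {\<omega> \<in> space M. \<bar>Z n \<omega> - c\<bar> > e}) \<longlonglongrightarrow> 0)"

(* The limit as K tends to infinity of limsup_n E[|Z_n|; |Z_n| > K] is 0. *)

definition asymptotically_uniformly_integrable ::
    "'a measure \<Rightarrow> (nat \<Rightarrow> 'a \<Rightarrow> real) \<Rightarrow> bool" where
  "asymptotically_uniformly_integrable M Z \<longleftrightarrow>
     (\<forall>e>0. \<exists>K. \<forall>\<^sub>F n in sequentially.
        (\<integral>\<^sup>+\<omega>. ennreal \<bar>Z n \<omega>\<bar> * indicator {\<omega>. \<bar>Z n \<omega>\<bar> > K} \<omega> \<partial>M) \<le> ennreal e)"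

(* Integrability is demanded explicitly because the Bochner integral of a non-integrable function
   is 0. *)

definition has_asymptotic_bias ::
    "'a measure \<Rightarrow> (nat \<Rightarrow> 'a \<Rightarrow> real) \<Rightarrow> real \<Rightarrow> real \<Rightarrow> bool" where
  "has_asymptotic_bias M T \<theta> a \<longleftrightarrow>
     (\<forall>\<^sub>F n in sequentially. integrable M (\<lambda>\<omega>. T n \<omega> - \<theta>)) \<and>
     (\<lambda>n. \<integral>\<omega>. (T n \<omega> - \<theta>) \<partial>M) \<longlonglongrightarrow> a"

definition has_asymptotic_mse ::
    "'a measure \<Rightarrow> (nat \<Rightarrow> 'a \<Rightarrow> real) \<Rightarrow> real \<Rightarrow> real \<Rightarrow> bool" where
  "has_asymptotic_mse M T \<theta> a \<longleftrightarrow>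
     (\<forall>\<^sub>F n in sequentially. integrable M (\<lambda>\<omega>. (T n \<omega> - \<theta>)\<^sup>2)) \<and>
     (\<lambda>n. \<integral>\<omega>. (T n \<omega> - \<theta>)\<^sup>2 \<partial>M) \<longlonglongrightarrow> a"

definition bias_G ::
    "'a measure \<Rightarrow> ('a \<Rightarrow> real) \<Rightarrow> ('a \<Rightarrow> real) \<Rightarrow> real \<Rightarrow> real \<Rightarrow> real" where
  "bias_G M X U s t =
     deriv (cgf M (\<lambda>\<omega>. X \<omega> + U \<omega>)) t - (\<integral>\<omega>. U \<omega> \<partial>M) - deriv (cgf M X) s"

(* g is the C^1 function on the open set S whose graph is the zero set of G in S x T. *)

definition C1_implicit_function ::
    "(real \<Rightarrow> real \<Rightarrow> real) \<Rightarrow> real set \<Rightarrow> real set \<Rightarrow> (real \<Rightarrow> real) \<Rightarrow> bool" where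
  "C1_implicit_function G S T g \<longleftrightarrow>
     open S \<and> open T \<and> g C1_differentiable_on S \<and> g ` S \<subseteq> T \<and>
     (\<forall>s\<in>S. \<forall>t\<in>T. G s t = 0 \<longleftrightarrow> t = g s)"

end

theory Submission
  imports Defs
begin

text \<open>
  The naive estimator converges in probability to the constant vector \<open>(b0, b1)\<close>. As its squares
  are asymptotically uniformly integrable, it also converges in mean square
  (\<open>asymptotically_uniformly_integrable_L2_convergence\<close>), and therefore its asymptotic biases are
  \<open>b0 - \<beta>0\<close> and \<open>b1 - \<beta>1\<close>, and its asymptotic mean squared errors are their squares
  (\<open>bias_mse_of_L2_convergence\<close>). It remains to compute \<open>b0\<close> and \<open>b1\<close>.

  Since $E[Y \mid X] = e^{\beta_0+\beta_1 X}$ (\<open>poisson_regression_integral\<close>) and \<open>U\<close> is independent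
  of \<open>Y\<close>, the limiting estimating equations read
  \[ e^{\beta_0} M_X(\beta_1) = e^{b_0} M_W(b_1), \qquad
     e^{\beta_0} \bigl(M_X'(\beta_1) + E[U]\, M_X(\beta_1)\bigr) = e^{b_0} M_W'(b_1). \]
  Their quotient is $K_X'(\beta_1) + E[U] = K_W'(b_1)$, that is $G(\beta_1, b_1) = 0$, and the
  logarithm of the first is the formula for $b_0 - \beta_0$ (\<open>naive_limit_equations\<close>).

  So $(\beta_1, b_1)$ itself is a zero of $G$, and $K_W''(b_1) \neq 0$ allows $G = 0$ to be solved
  for its second variable near this point. As $G$ is a difference of a function of $b_1$ and a
  function of $\beta_1$, inverting the strictly monotone function $K_W'$ near $b_1$ suffices
  (\<open>separable_implicit_function\<close>). The regularity that this requires, namely that cumulant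
  generating functions are twice continuously differentiable inside their domain (\<open>cgf_C2\<close>), comes
  from differentiation under the integral sign (\<open>DERIV_exp_moment\<close>).
\<close>

section \<open>Exponential moments and cumulant generating functions\<close>

definition exp_moment :: "'a measure \<Rightarrow> ('a \<Rightarrow> real) \<Rightarrow> nat \<Rightarrow> real \<Rightarrow> real" where
  "exp_moment M Z k t = (\<integral>\<omega>. Z \<omega> ^ k * exp (t * Z \<omega>) \<partial>M)"

lemma exp_abs_le: "exp (r * \<bar>z\<bar>) \<le> exp (r * z) + exp (- r * z)" for r z :: real
  by (cases "z \<ge> 0") (auto simp: abs_if intro: add_increasing add_increasing2)

text \<open>
  Polynomial factors cost nothing in the interior of the domain of a moment generating function:
  by the exponential series $(r|z|)^k/k! \le e^{r|z|}$, so a power of $z$ is absorbed by moving the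
  exponent $t$ by $r$ to either side. This is the source of all dominating functions below.
\<close>

lemma power_times_exp_le:
  fixes r t z :: real
  assumes "r > 0"
  shows "\<bar>z\<bar> ^ k * exp (t * z) \<le> fact k / r ^ k * (exp ((t + r) * z) + exp ((t - r) * z))"
proof -
  have "(r * \<bar>z\<bar>) ^ k / fact k \<le> exp (r * \<bar>z\<bar>)"
  proof -
    have "(r * \<bar>z\<bar>) ^ k /\<^sub>R fact k \<le> (\<Sum>n. (r * \<bar>z\<bar>) ^ n /\<^sub>R fact n)"
      using sum_le_suminf[OF summable_exp_generic[of "r * \<bar>z\<bar>"], of "{k}"] assms by simp
    then show ?thesis
      by (simp add: exp_def divide_inverse mult.commute)
  qed
  also have "\<dots> \<le> exp (r * z) + exp (- r * z)"
    by (rule exp_abs_le)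
  finally have "\<bar>z\<bar> ^ k \<le> fact k / r ^ k * (exp (r * z) + exp (- r * z))"
    using assms by (simp add: field_simps power_mult_distrib)
  then have "\<bar>z\<bar> ^ k * exp (t * z) \<le> fact k / r ^ k * (exp (r * z) + exp (- r * z)) * exp (t * z)"
    by (rule mult_right_mono) simp
  also have "\<dots> = fact k / r ^ k * (exp ((t + r) * z) + exp ((t - r) * z))"
    by (simp add: algebra_simps exp_add exp_diff exp_minus field_simps)
  finally show ?thesis .
qed

lemma interior_shift:
  fixes t :: real
  assumes "t \<in> interior D"
  obtains r where "r > 0" "\<And>u. \<bar>u - t\<bar> \<le> r \<Longrightarrow> u \<in> interior D"
proof -
  obtain r where "r > 0" "cball t r \<subseteq> interior D"
    using open_contains_cball[of "interior D"] assms by auto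
  then show ?thesis
    by (intro that[of r]) (auto simp: subset_eq dist_real_def abs_minus_commute)
qed

lemma integrable_power_times_exp:
  assumes [measurable]: "Z \<in> borel_measurable M" and t: "t \<in> interior (mgf_domain M Z)"
  shows "integrable M (\<lambda>\<omega>. \<bar>Z \<omega>\<bar> ^ k * exp (t * Z \<omega>))"
proof -
  obtain r where r: "r > 0" "\<And>u. \<bar>u - t\<bar> \<le> r \<Longrightarrow> u \<in> interior (mgf_domain M Z)"
    using interior_shift[OF t] by blast
  have "t + r \<in> mgf_domain M Z" "t - r \<in> mgf_domain M Z"
    using r(2)[of "t + r"] r(2)[of "t - r"] r(1) interior_subset by auto
  then have "integrable M (\<lambda>\<omega>. fact k / r ^ k * (exp ((t + r) * Z \<omega>) + exp ((t - r) * Z \<omega>)))"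
    by (simp add: mgf_domain_def)
  then show ?thesis
    by (rule Bochner_Integration.integrable_bound)
      (use power_times_exp_le[OF r(1), of _ k t] r(1) in \<open>auto simp: abs_mult power_abs\<close>)
qed

lemma integrable_exp_moment:
  assumes [measurable]: "Z \<in> borel_measurable M" and t: "t \<in> interior (mgf_domain M Z)"
  shows "integrable M (\<lambda>\<omega>. Z \<omega> ^ k * exp (t * Z \<omega>))"
  by (rule Bochner_Integration.integrable_bound[OF integrable_power_times_exp[OF assms]])
     (auto simp: abs_mult power_abs)

lemma abs_exp_minus_one_le: "\<bar>exp x - 1\<bar> \<le> \<bar>x\<bar> * exp \<bar>x\<bar>" for x :: real
proof -
  have "1 + x \<le> exp x" "1 - x \<le> exp (- x)" using exp_ge_add_one_self[of x] exp_ge_add_one_self[of "-x"] by auto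
  show ?thesis
  proof (cases "x \<ge> 0")
    case True
    have "(1 - x) * exp x \<le> exp (- x) * exp x"
      using \<open>1 - x \<le> exp (- x)\<close> by (intro mult_right_mono) auto
    then show ?thesis using True by (simp add: exp_minus field_simps)
  next
    case False
    have "- x * 1 \<le> - x * exp (- x)" using False by (intro mult_left_mono) auto
    moreover have "\<bar>exp x - 1\<bar> = 1 - exp x" "\<bar>x\<bar> = - x" using False by auto
    moreover have "1 - exp x \<le> - x * exp (- x)"
      using \<open>1 + x \<le> exp x\<close> \<open>- x * 1 \<le> - x * exp (- x)\<close> by linarith
    ultimately show ?thesis by simp
  qed
qed

text \<open>
  Differentiation under the integral sign. For increments \<open>h\<close> with $|h| \le r$ the difference
  quotients of $e^{tz}$ are at most $|z|\,e^{tz} e^{r|z|}$, which is integrable even with a further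
  factor $|z|^k$ when $t \pm r$ are still interior points, so that dominated convergence applies.
\<close>

lemma DERIV_exp_moment:
  assumes [measurable]: "Z \<in> borel_measurable M" and t: "t \<in> interior (mgf_domain M Z)"
  shows "(exp_moment M Z k has_real_derivative exp_moment M Z (Suc k) t) (at t)"
proof -
  obtain r where r: "r > 0" "\<And>u. \<bar>u - t\<bar> \<le> r \<Longrightarrow> u \<in> interior (mgf_domain M Z)"
    using interior_shift[OF t] by blast
  note int = integrable_exp_moment[OF assms(1)]
  define w where "w = (\<lambda>\<omega>. \<bar>Z \<omega>\<bar> ^ Suc k * exp ((t + r) * Z \<omega>) + \<bar>Z \<omega>\<bar> ^ Suc k * exp ((t - r) * Z \<omega>))"
  have w: "integrable M w"
    unfolding w_def using r by (intro Bochner_Integration.integrable_add integrable_power_times_exp) auto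
  show ?thesis
    unfolding DERIV_def tendsto_at_iff_sequentially comp_def
  proof (intro allI impI)
    fix x :: "nat \<Rightarrow> real" assume x: "\<forall>i. x i \<in> UNIV - {0}" "x \<longlonglongrightarrow> 0"
    define q where "q = (\<lambda>i \<omega>. Z \<omega> ^ k * exp (t * Z \<omega>) * ((exp (x i * Z \<omega>) - 1) / x i))"
    \<comment> \<open>Dominated convergence needs the bound for all indices, hence the shift of the sequence by \<open>N\<close>.\<close>
    obtain N where N: "\<And>i. i \<ge> N \<Longrightarrow> \<bar>x i\<bar> \<le> r"
      using LIMSEQ_D[OF x(2) r(1)] by (auto intro: less_imp_le)
    have "(\<lambda>i. \<integral>\<omega>. q (i + N) \<omega> \<partial>M) \<longlonglongrightarrow> (\<integral>\<omega>. Z \<omega> ^ Suc k * exp (t * Z \<omega>) \<partial>M)"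
    proof (rule integral_dominated_convergence[OF _ _ w])
      show "AE \<omega> in M. (\<lambda>i. q (i + N) \<omega>) \<longlonglongrightarrow> Z \<omega> ^ Suc k * exp (t * Z \<omega>)"
      proof (rule AE_I2)
        fix \<omega>
        have "((\<lambda>h. exp (h * Z \<omega>)) has_real_derivative Z \<omega>) (at 0)"
          by (auto intro!: derivative_eq_intros)
        then have "((\<lambda>h. (exp (h * Z \<omega>) - 1) / h) \<longlongrightarrow> Z \<omega>) (at 0)"
          by (simp add: DERIV_def)
        then have "(\<lambda>i. (exp (x i * Z \<omega>) - 1) / x i) \<longlonglongrightarrow> Z \<omega>"
          using x unfolding tendsto_at_iff_sequentially comp_def by blast
        then have "(\<lambda>i. q i \<omega>) \<longlonglongrightarrow> Z \<omega> ^ k * exp (t * Z \<omega>) * Z \<omega>"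
          unfolding q_def by (intro tendsto_intros)
        from LIMSEQ_ignore_initial_segment[OF this, of N]
        show "(\<lambda>i. q (i + N) \<omega>) \<longlonglongrightarrow> Z \<omega> ^ Suc k * exp (t * Z \<omega>)"
          by (simp add: mult_ac)
      qed
      show "AE \<omega> in M. norm (q (i + N) \<omega>) \<le> w \<omega>" for i
      proof (rule AE_I2)
        fix \<omega>
        define h where "h = x (i + N)"
        have h: "h \<noteq> 0" "\<bar>h\<bar> \<le> r" using x(1) N[of "i + N"] by (auto simp: h_def)
        have "\<bar>exp (h * Z \<omega>) - 1\<bar> \<le> \<bar>h * Z \<omega>\<bar> * exp \<bar>h * Z \<omega>\<bar>"
          by (rule abs_exp_minus_one_le)
        also have "\<dots> \<le> \<bar>h * Z \<omega>\<bar> * exp (r * \<bar>Z \<omega>\<bar>)"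
          using h by (intro mult_left_mono) (auto simp: abs_mult intro: mult_right_mono)
        also have "\<dots> \<le> \<bar>h * Z \<omega>\<bar> * (exp (r * Z \<omega>) + exp (- r * Z \<omega>))"
          by (intro mult_left_mono exp_abs_le) auto
        finally have "\<bar>(exp (h * Z \<omega>) - 1) / h\<bar> \<le> \<bar>Z \<omega>\<bar> * (exp (r * Z \<omega>) + exp (- r * Z \<omega>))"
          using h by (simp add: abs_mult field_simps)
        then have "\<bar>Z \<omega>\<bar> ^ k * exp (t * Z \<omega>) * \<bar>(exp (h * Z \<omega>) - 1) / h\<bar>
            \<le> \<bar>Z \<omega>\<bar> ^ k * exp (t * Z \<omega>) * (\<bar>Z \<omega>\<bar> * (exp (r * Z \<omega>) + exp (- r * Z \<omega>)))"
          by (intro mult_left_mono) auto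
        also have "\<dots> = w \<omega>"
          by (simp add: w_def algebra_simps exp_add exp_diff exp_minus field_simps)
        finally show "norm (q (i + N) \<omega>) \<le> w \<omega>"
          by (simp add: q_def h_def abs_mult power_abs)
      qed
    qed (simp_all add: q_def)
    moreover have "(exp_moment M Z k (t + x (i + N)) - exp_moment M Z k t) / x (i + N)
        = (\<integral>\<omega>. q (i + N) \<omega> \<partial>M)" for i
    proof -
      have "integrable M (\<lambda>\<omega>. Z \<omega> ^ k * exp ((t + x (i + N)) * Z \<omega>))"
        "integrable M (\<lambda>\<omega>. Z \<omega> ^ k * exp (t * Z \<omega>))"
        using N[of "i + N"] t by (auto intro!: int r(2))
      then have "(exp_moment M Z k (t + x (i + N)) - exp_moment M Z k t) / x (i + N)
        = (\<integral>\<omega>. (Z \<omega> ^ k * exp ((t + x (i + N)) * Z \<omega>) - Z \<omega> ^ k * exp (t * Z \<omega>)) / x (i + N) \<partial>M)"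
        by (simp add: exp_moment_def)
      also have "\<dots> = (\<integral>\<omega>. q (i + N) \<omega> \<partial>M)"
        by (intro Bochner_Integration.integral_cong)
           (auto simp: q_def algebra_simps exp_add diff_divide_distrib)
      finally show ?thesis .
    qed
    ultimately have "(\<lambda>i. (exp_moment M Z k (t + x (i + N)) - exp_moment M Z k t) / x (i + N))
        \<longlonglongrightarrow> exp_moment M Z (Suc k) t"
      by (simp add: exp_moment_def)
    then show "(\<lambda>i. (exp_moment M Z k (t + x i) - exp_moment M Z k t) / x i) \<longlonglongrightarrow> exp_moment M Z (Suc k) t"
      by (rule LIMSEQ_offset)
  qed
qed

lemma mgf_eq_exp_moment: "mgf M Z = exp_moment M Z 0"
  by (simp add: mgf_def exp_moment_def fun_eq_iff)

lemma (in prob_space) mgf_pos: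
  assumes "t \<in> mgf_domain M Z"
  shows "mgf M Z t > 0"
proof -
  have int: "integrable M (\<lambda>\<omega>. exp (t * Z \<omega>))" using assms by (simp add: mgf_domain_def)
  have "mgf M Z t \<noteq> 0"
    using integral_nonneg_eq_0_iff_AE[OF int] AE_False by (simp add: mgf_def)
  moreover have "mgf M Z t \<ge> 0" by (simp add: mgf_def)
  ultimately show ?thesis by simp
qed

text \<open>
  The function \<open>deriv\<close> is total, so a value of an iterated \<open>deriv\<close> says nothing about
  differentiability. These facts certify that on the interior of the domain the first two iterated
  derivatives of the cumulant generating function are genuine, and that the second is continuous.
\<close>

lemma (in prob_space) cgf_C2:
  assumes [measurable]: "Z \<in> borel_measurable M" and t: "t \<in> interior (mgf_domain M Z)"
  shows cgf_deriv_eq: "deriv (cgf M Z) t = exp_moment M Z 1 t / mgf M Z t"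
    and DERIV_deriv_cgf: "(deriv (cgf M Z) has_real_derivative (deriv ^^ 2) (cgf M Z) t) (at t)"
    and isCont_cgf_second: "isCont ((deriv ^^ 2) (cgf M Z)) t"
proof -
  let ?I = "interior (mgf_domain M Z)"
  let ?m = "exp_moment M Z"
  have pos: "?m 0 u > 0" if "u \<in> ?I" for u
    using mgf_pos that interior_subset by (metis mgf_eq_exp_moment subsetD)
  note D = DERIV_exp_moment[OF assms(1)]
  have D1: "(cgf M Z has_real_derivative ?m 1 u / ?m 0 u) (at u)" if "u \<in> ?I" for u
    unfolding cgf_def[abs_def] mgf_eq_exp_moment
    using D[OF that, of 0] pos[OF that] by (auto intro!: derivative_eq_intros)
  have e1: "deriv (cgf M Z) u = ?m 1 u / ?m 0 u" if "u \<in> ?I" for u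
    using D1[OF that] by (rule DERIV_imp_deriv)
  define K2 where "K2 = (\<lambda>u. (?m 2 u * ?m 0 u - ?m 1 u * ?m 1 u) / (?m 0 u * ?m 0 u))"
  have near: "\<forall>\<^sub>F v in nhds u. v \<in> ?I" if "u \<in> ?I" for u
    using that by (intro eventually_nhds_in_open) auto
  have D2: "(deriv (cgf M Z) has_real_derivative K2 u) (at u)" if "u \<in> ?I" for u
  proof -
    have "((\<lambda>u. ?m 1 u / ?m 0 u) has_real_derivative K2 u) (at u)"
      using D[OF that, of 0] D[OF that, of 1] pos[OF that] unfolding K2_def
      by (auto intro!: derivative_eq_intros simp: numeral_2_eq_2)
    moreover have "\<forall>\<^sub>F v in nhds u. deriv (cgf M Z) v = ?m 1 v / ?m 0 v"
      using near[OF that] by eventually_elim (rule e1)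
    ultimately show ?thesis
      by (subst DERIV_cong_ev[OF refl _ refl]) auto
  qed
  have e2: "(deriv ^^ 2) (cgf M Z) u = K2 u" if "u \<in> ?I" for u
    using D2[OF that] by (simp add: numeral_2_eq_2 DERIV_imp_deriv)
  show "deriv (cgf M Z) t = ?m 1 t / mgf M Z t"
    using e1[OF t] by (simp add: mgf_eq_exp_moment)
  show "(deriv (cgf M Z) has_real_derivative (deriv ^^ 2) (cgf M Z) t) (at t)"
    using D2[OF t] by (simp only: e2[OF t])
  have "isCont K2 t"
    unfolding K2_def using D[OF t, THEN DERIV_isCont] pos[OF t] by (intro continuous_intros) auto
  moreover have "\<forall>\<^sub>F v in nhds t. (deriv ^^ 2) (cgf M Z) v = K2 v"
    using near[OF t] by eventually_elim (rule e2)
  ultimately show "isCont ((deriv ^^ 2) (cgf M Z)) t"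
    by (subst isCont_cong)
qed

section \<open>Implicit functions of separable equations\<close>

text \<open>
  An equation \<open>k t = h s\<close> with separated variables needs no general implicit function theorem.
  Near \<open>b\<close> the derivative of \<open>k\<close> does not vanish, so there \<open>k\<close> is injective by the mean value
  theorem, and open by invariance of domain; hence \<open>g\<close> is the inverse of \<open>k\<close> on that interval,
  composed with \<open>h\<close>, and its derivative is given by the chain rule.
\<close>

lemma separable_implicit_function:
  fixes h k h' k' :: "real \<Rightarrow> real"
  assumes A: "open A" "a \<in> A" and B: "open B" "b \<in> B"
    and h: "\<And>s. s \<in> A \<Longrightarrow> (h has_real_derivative h' s) (at s)" and h': "continuous_on A h'"
    and k: "\<And>t. t \<in> B \<Longrightarrow> (k has_real_derivative k' t) (at t)" and k': "continuous_on B k'"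
    and nz: "k' b \<noteq> 0" and eq: "k b = h a"
  obtains S T g where "a \<in> S" "S \<subseteq> A" "b \<in> T" "T \<subseteq> B" "b = g a"
    "C1_implicit_function (\<lambda>s t. k t - h s) S T g"
proof -
  have "\<forall>\<^sub>F t in nhds b. k' t \<noteq> 0"
    using k' B nz by (metis continuous_on_eq_continuous_at isCont_def t1_space_nhds tendsto_imp_eventually_ne
        eventually_nhds_conv_at)
  then obtain V where V: "open V" "b \<in> V" "\<And>t. t \<in> V \<Longrightarrow> k' t \<noteq> 0"
    unfolding eventually_nhds by blast
  obtain \<delta> where \<delta>: "\<delta> > 0" "ball b \<delta> \<subseteq> V \<inter> B"
    using open_contains_ball[of "V \<inter> B"] V B by (metis IntI open_Int)
  define T where "T = ball b \<delta>"
  have T: "open T" "b \<in> T" "T \<subseteq> B" "\<And>t. t \<in> T \<Longrightarrow> k' t \<noteq> 0" "convex T"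
    using \<delta> V(3) by (auto simp: T_def)
  have kT: "continuous_on T k"
    using k T(3) by (intro continuous_at_imp_continuous_on ballI DERIV_isCont) auto
  have neq: "k x \<noteq> k y" if "x \<in> T" "y \<in> T" "x < y" for x y
  proof
    assume "k x = k y"
    have sub: "{x..y} \<subseteq> T"
      using T(5) that by (simp add: closed_segment_subset flip: closed_segment_eq_real_ivl1)
    obtain z where z: "x < z" "z < y" "k y - k x = (y - x) * k' z"
      using MVT2[OF \<open>x < y\<close>, of k k'] k sub T(3) by (metis atLeastAtMost_iff subsetD)
    then have "k' z = 0" using \<open>k x = k y\<close> that(3) by simp
    then show False using T(4)[of z] sub z by (auto simp: subset_eq)
  qed
  then have inj: "inj_on k T"
    by (intro inj_onI) (metis linorder_less_linear)
  have op: "open (k ` T)"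
    using T(1) kT inj by (rule invariance_of_domain_gen) auto
  define g where "g = (\<lambda>s. inv_into T k (h s))"
  have "continuous_on A h"
    using h by (intro continuous_at_imp_continuous_on ballI DERIV_isCont) auto
  define S where "S = A \<inter> h -` (k ` T)"
  have S: "open S"
    unfolding S_def using \<open>continuous_on A h\<close> A(1) op by (rule continuous_open_preimage)
  have aS: "a \<in> S" using A(2) T(2) eq by (auto simp: S_def intro: image_eqI[of _ _ b])
  have ginv: "inv_into T k (k t) = t" if "t \<in> T" for t
    using inj that by (rule inv_into_f_f)
  have gT: "g s \<in> T" "k (g s) = h s" if "s \<in> S" for s
    using that unfolding S_def g_def by (auto intro: inv_into_into f_inv_into_f)
  have iff: "k t - h s = 0 \<longleftrightarrow> t = g s" if "s \<in> S" "t \<in> T" for s t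
    using gT[OF that(1)] inj that(2) by (metis eq_iff_diff_eq_0 inj_onD)
  have Dg: "(g has_real_derivative inverse (k' (g s)) * h' s) (at s)" if "s \<in> S" for s
  proof -
    have "(inv_into T k has_real_derivative inverse (k' (g s))) (at (k (g s)))"
      unfolding has_field_derivative_def
    proof (rule has_derivative_inverse_strong[OF T(1) gT(1)[OF that] kT ginv])
      show "(k has_derivative (*) (k' (g s))) (at (g s))"
        using k[of "g s"] gT(1)[OF that] T(3) by (auto simp: has_field_derivative_def)
      show "(*) (k' (g s)) \<circ> (*) (inverse (k' (g s))) = id"
        using T(4)[OF gT(1)[OF that]] by (simp add: fun_eq_iff)
    qed
    then have "(inv_into T k has_real_derivative inverse (k' (g s))) (at (h s))"
      using gT(2)[OF that] by simp
    from DERIV_chain2[OF this h] show ?thesis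
      using that unfolding g_def S_def by auto
  qed
  have "continuous_on S (\<lambda>s. inverse (k' (g s)) * h' s)"
  proof (intro continuous_intros)
    have "continuous_on S g"
      using Dg by (intro continuous_at_imp_continuous_on ballI DERIV_isCont) auto
    then show "continuous_on S (\<lambda>s. k' (g s))"
      by (rule continuous_on_compose2[OF k']) (use gT T(3) in auto)
    show "continuous_on S h'" using h' by (rule continuous_on_subset) (auto simp: S_def)
    show "\<forall>s\<in>S. k' (g s) \<noteq> 0" using gT T(4) by auto
  qed
  then have "g C1_differentiable_on S"
    unfolding C1_differentiable_on_def using Dg
    by (intro exI[of _ "\<lambda>s. inverse (k' (g s)) * h' s"])
       (simp add: has_real_derivative_iff_has_vector_derivative)
  then have "C1_implicit_function (\<lambda>s t. k t - h s) S T g"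
    unfolding C1_implicit_function_def using S T(1) gT iff by blast
  moreover have "b = g a"
    using iff[OF aS T(2)] eq by simp
  ultimately show ?thesis
    using aS T(2,3) by (intro that[of S T g]) (auto simp: S_def)
qed

section \<open>Conditional Poisson means\<close>

text \<open>
  The defining property of conditional expectation, with the real conditional probability of
  \<open>Y \<in> B\<close> replaced by the Poisson probability. The extended nonnegative version is used because
  \<open>h\<close> may be unbounded; the two notions of conditional expectation agree here since the conditional
  expectation of an indicator is at most 1, in particular finite.
\<close>

lemma (in prob_space) poisson_regression_nn_integral_indicator:
  fixes h :: "real \<Rightarrow> ennreal"
  assumes X[measurable]: "X \<in> borel_measurable M" and Y[measurable]: "Y \<in> borel_measurable M"
    and model: "poisson_regression M \<beta>0 \<beta>1 X Y"
    and B[measurable]: "B \<in> sets borel" and h[measurable]: "h \<in> borel_measurable borel"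
  shows "(\<integral>\<^sup>+\<omega>. h (X \<omega>) * indicator B (Y \<omega>) \<partial>M)
    = (\<integral>\<^sup>+\<omega>. h (X \<omega>) * ennreal (measure (poisson_pmf (exp (\<beta>0 + \<beta>1 * X \<omega>))) (real -` B)) \<partial>M)"
proof -
  define F where "F = vimage_algebra (space M) X borel"
  have sub: "subalgebra M F"
    unfolding subalgebra_def F_def
    using X by (auto simp: sets_vimage_algebra2 measurable_sets)
  interpret finite_measure_subalgebra M F
    by unfold_locales (rule sub)
  define E where "E = Y -` B \<inter> space M"
  have E[measurable]: "E \<in> sets M" by (simp add: E_def)
  let ?c = "nn_cond_exp M F (\<lambda>\<omega>. ennreal (indicator E \<omega>))"
  have "AE \<omega> in M. ?c \<omega> \<le> nn_cond_exp M F (\<lambda>_. 1) \<omega>"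
    by (rule nn_cond_exp_mono) (auto simp: indicator_def)
  moreover have "AE \<omega> in M. 1 = nn_cond_exp M F (\<lambda>_. 1) \<omega>"
    by (rule nn_cond_exp_F_meas) simp
  moreover have "AE \<omega> in M. 0 = nn_cond_exp M F (\<lambda>_. 0) \<omega>"
    by (rule nn_cond_exp_F_meas) simp
  moreover have "AE \<omega> in M. real_cond_exp M F (indicator E) \<omega>
      = measure (poisson_pmf (exp (\<beta>0 + \<beta>1 * X \<omega>))) (real -` B)"
    using model B unfolding poisson_regression_def F_def E_def by blast
  ultimately have "AE \<omega> in M. ennreal (measure (poisson_pmf (exp (\<beta>0 + \<beta>1 * X \<omega>))) (real -` B)) = ?c \<omega>"
  proof eventually_elim
    case (elim \<omega>)
    have "(\<lambda>\<omega>. ennreal (- indicator E \<omega>)) = (\<lambda>_. 0)"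
      by (auto simp: fun_eq_iff indicator_def ennreal_neg)
    then have "real_cond_exp M F (indicator E) \<omega> = enn2real (?c \<omega>)"
      using elim(3) by (simp add: real_cond_exp_def)
    moreover have "?c \<omega> < top" using elim(1,2) by (metis ennreal_one_less_top order_le_less_trans)
    ultimately show ?case using elim(4) by simp
  qed
  then have "(\<integral>\<^sup>+\<omega>. h (X \<omega>) * ennreal (measure (poisson_pmf (exp (\<beta>0 + \<beta>1 * X \<omega>))) (real -` B)) \<partial>M)
      = (\<integral>\<^sup>+\<omega>. h (X \<omega>) * ?c \<omega> \<partial>M)"
    by (intro nn_integral_cong_AE) auto
  also have "\<dots> = (\<integral>\<^sup>+\<omega>. h (X \<omega>) * ennreal (indicator E \<omega>) \<partial>M)"
  proof (rule nn_cond_exp_intg)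
    have "X \<in> borel_measurable F" unfolding F_def by (rule measurable_vimage_algebra1) auto
    then show "(\<lambda>\<omega>. h (X \<omega>)) \<in> borel_measurable F" by measurable
  qed simp
  also have "\<dots> = (\<integral>\<^sup>+\<omega>. h (X \<omega>) * indicator B (Y \<omega>) \<partial>M)"
    by (intro nn_integral_cong) (auto simp: E_def indicator_def)
  finally show ?thesis by simp
qed

lemma suminf_poisson_mean:
  fixes r :: real
  assumes "r > 0"
  shows "(\<Sum>k. ennreal (real k * pmf (poisson_pmf r) k)) = ennreal r"
proof -
  have "(\<lambda>k. r ^ k /\<^sub>R fact k) sums exp r" by (rule exp_converges)
  \<comment> \<open>Up to an index shift, the series of the mean is \<open>r\<close> times the series of total mass.\<close>
  then have "(\<lambda>k. exp (- r) * r * (r ^ k /\<^sub>R fact k)) sums (exp (- r) * r * exp r)"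
    by (rule sums_mult)
  moreover have "exp (- r) * r * (r ^ k /\<^sub>R fact k) = real (Suc k) * pmf (poisson_pmf r) (Suc k)" for k
    using assms by (simp add: field_simps del: of_nat_Suc)
  moreover have "exp (- r) * r * exp r = r" by (simp add: exp_minus)
  ultimately have "(\<lambda>k. real (Suc k) * pmf (poisson_pmf r) (Suc k)) sums r" by simp
  then have "(\<lambda>k. real k * pmf (poisson_pmf r) k) sums r"
    by (subst (asm) sums_Suc_iff) simp
  then show ?thesis
    by (intro suminf_ennreal_eq) auto
qed

lemma (in prob_space) poisson_regression_AE_nat:
  assumes [measurable]: "X \<in> borel_measurable M" "Y \<in> borel_measurable M"
    and model: "poisson_regression M \<beta>0 \<beta>1 X Y"
  shows "AE \<omega> in M. Y \<omega> \<in> range real"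
proof -
  have [measurable]: "range real \<in> sets borel" by (rule sets.countable) auto
  have "(\<integral>\<^sup>+\<omega>. indicator (range real) (Y \<omega>) \<partial>M) = 1"
    using poisson_regression_nn_integral_indicator[OF assms(1,2) model, of "range real" "\<lambda>_. 1"]
    by (simp add: emeasure_space_1 inj_vimage_image_eq measure_pmf.prob_space[simplified])
  then have "emeasure M {\<omega> \<in> space M. Y \<omega> \<in> range real} = 1"
    by (subst (asm) nn_integral_cong[where v = "indicator {\<omega> \<in> space M. Y \<omega> \<in> range real}"])
       (auto simp: indicator_def)
  then have "prob {\<omega> \<in> space M. Y \<omega> \<in> range real} = 1"
    by (simp add: measure_def)
  then show ?thesis by (subst (asm) prob_Collect_eq_1) auto
qed

text \<open>
  The real-valued response is almost surely a natural number, so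
  $Y = \sum_k k\,1_{\{Y=k\}}$ and monotone convergence reduces the conditional mean of $Y$ to the
  mean of the Poisson law.
\<close>

lemma (in prob_space) poisson_regression_nn_integral:
  fixes h :: "real \<Rightarrow> ennreal"
  assumes X[measurable]: "X \<in> borel_measurable M" and Y[measurable]: "Y \<in> borel_measurable M"
    and model: "poisson_regression M \<beta>0 \<beta>1 X Y"
    and h[measurable]: "h \<in> borel_measurable borel"
  shows "(\<integral>\<^sup>+\<omega>. h (X \<omega>) * ennreal (Y \<omega>) \<partial>M) = (\<integral>\<^sup>+\<omega>. h (X \<omega>) * ennreal (exp (\<beta>0 + \<beta>1 * X \<omega>)) \<partial>M)"
proof -
  let ?p = "\<lambda>k \<omega>. pmf (poisson_pmf (exp (\<beta>0 + \<beta>1 * X \<omega>))) k"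
  have [measurable]: "?p k \<in> borel_measurable M" for k by simp
  have "(\<integral>\<^sup>+\<omega>. h (X \<omega>) * ennreal (Y \<omega>) \<partial>M)
      = (\<integral>\<^sup>+\<omega>. (\<Sum>k. ennreal (real k) * (h (X \<omega>) * indicator {real k} (Y \<omega>))) \<partial>M)"
  proof (rule nn_integral_cong_AE)
    show "AE \<omega> in M. h (X \<omega>) * ennreal (Y \<omega>)
        = (\<Sum>k. ennreal (real k) * (h (X \<omega>) * indicator {real k} (Y \<omega>)))"
      using poisson_regression_AE_nat[OF X Y model]
    proof eventually_elim
      case (elim \<omega>)
      then obtain n where n: "Y \<omega> = real n" by auto
      have "(\<Sum>k. ennreal (real k) * (h (X \<omega>) * indicator {real k} (Y \<omega>)))
          = (\<Sum>k\<in>{n}. ennreal (real k) * (h (X \<omega>) * indicator {real k} (Y \<omega>)))"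
        by (rule suminf_finite) (auto simp: n)
      then show ?case by (simp add: n mult.commute)
    qed
  qed
  also have "\<dots> = (\<Sum>k. ennreal (real k) * (\<integral>\<^sup>+\<omega>. h (X \<omega>) * indicator {real k} (Y \<omega>) \<partial>M))"
    by (subst nn_integral_suminf) (auto simp: nn_integral_cmult)
  also have "\<dots> = (\<Sum>k. ennreal (real k) * (\<integral>\<^sup>+\<omega>. h (X \<omega>) * ennreal (?p k \<omega>) \<partial>M))"
  proof -
    have "real -` {real k} = {k}" for k by auto
    then show ?thesis
      by (subst poisson_regression_nn_integral_indicator[OF X Y model])
        (auto simp: measure_pmf_single simp del: pmf_poisson)
  qed
  also have "\<dots> = (\<integral>\<^sup>+\<omega>. (\<Sum>k. ennreal (real k) * (h (X \<omega>) * ennreal (?p k \<omega>))) \<partial>M)"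
    by (subst nn_integral_suminf) (auto simp: nn_integral_cmult simp del: pmf_poisson)
  also have "\<dots> = (\<integral>\<^sup>+\<omega>. h (X \<omega>) * (\<Sum>k. ennreal (real k * ?p k \<omega>)) \<partial>M)"
    by (intro nn_integral_cong) (simp add: ennreal_mult mult_ac flip: ennreal_suminf_cmult del: pmf_poisson)
  also have "\<dots> = (\<integral>\<^sup>+\<omega>. h (X \<omega>) * ennreal (exp (\<beta>0 + \<beta>1 * X \<omega>)) \<partial>M)"
    by (subst suminf_poisson_mean) auto
  finally show ?thesis .
qed

lemma (in prob_space) poisson_regression_integral:
  fixes h :: "real \<Rightarrow> real"
  assumes X[measurable]: "X \<in> borel_measurable M" and Y[measurable]: "Y \<in> borel_measurable M"
    and model: "poisson_regression M \<beta>0 \<beta>1 X Y"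
    and h[measurable]: "h \<in> borel_measurable borel"
    and int: "integrable M (\<lambda>\<omega>. h (X \<omega>) * exp (\<beta>0 + \<beta>1 * X \<omega>))"
  shows "has_bochner_integral M (\<lambda>\<omega>. h (X \<omega>) * Y \<omega>) (\<integral>\<omega>. h (X \<omega>) * exp (\<beta>0 + \<beta>1 * X \<omega>) \<partial>M)"
proof -
  let ?e = "\<lambda>\<omega>. exp (\<beta>0 + \<beta>1 * X \<omega>)"
  have Y0: "AE \<omega> in M. Y \<omega> \<ge> 0"
    using poisson_regression_AE_nat[OF X Y model] by eventually_elim auto
  have nonneg: "has_bochner_integral M (\<lambda>\<omega>. f (X \<omega>) * Y \<omega>) (\<integral>\<omega>. f (X \<omega>) * ?e \<omega> \<partial>M)"
    if [measurable]: "f \<in> borel_measurable borel" and f: "\<And>x. f x \<ge> 0"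
      and i: "integrable M (\<lambda>\<omega>. f (X \<omega>) * ?e \<omega>)" for f :: "real \<Rightarrow> real"
  proof (rule has_bochner_integral_nn_integral)
    have "(\<integral>\<^sup>+\<omega>. ennreal (f (X \<omega>) * Y \<omega>) \<partial>M) = (\<integral>\<^sup>+\<omega>. ennreal (f (X \<omega>)) * ennreal (Y \<omega>) \<partial>M)"
      by (intro nn_integral_cong) (simp add: ennreal_mult' f)
    also have "\<dots> = (\<integral>\<^sup>+\<omega>. ennreal (f (X \<omega>)) * ennreal (?e \<omega>) \<partial>M)"
      by (rule poisson_regression_nn_integral[OF X Y model]) simp
    also have "\<dots> = (\<integral>\<^sup>+\<omega>. ennreal (f (X \<omega>) * ?e \<omega>) \<partial>M)"
      by (simp add: ennreal_mult' f)
    also have "\<dots> = ennreal (\<integral>\<omega>. f (X \<omega>) * ?e \<omega> \<partial>M)"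
      by (rule nn_integral_eq_integral[OF i]) (simp add: f)
    finally show "(\<integral>\<^sup>+\<omega>. ennreal (f (X \<omega>) * Y \<omega>) \<partial>M) = ennreal (\<integral>\<omega>. f (X \<omega>) * ?e \<omega> \<partial>M)" .
    show "AE \<omega> in M. 0 \<le> f (X \<omega>) * Y \<omega>" using Y0 by eventually_elim (simp add: f)
    show "0 \<le> (\<integral>\<omega>. f (X \<omega>) * ?e \<omega> \<partial>M)" by (simp add: f)
  qed measurable
  \<comment> \<open>The nonnegative case applies to the positive and the negative part of \<open>h\<close>.\<close>
  have parts: "max 0 (h (X \<omega>)) * ?e \<omega> = max 0 (h (X \<omega>) * ?e \<omega>)"
    "max 0 (- h (X \<omega>)) * ?e \<omega> = max 0 (- (h (X \<omega>) * ?e \<omega>))" for \<omega>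
    by (auto simp: max_def mult_le_0_iff zero_le_mult_iff)
  have i: "integrable M (\<lambda>\<omega>. max 0 (h (X \<omega>)) * ?e \<omega>)" "integrable M (\<lambda>\<omega>. max 0 (- h (X \<omega>)) * ?e \<omega>)"
    unfolding parts using int by (auto intro!: integrable_max)
  have "has_bochner_integral M (\<lambda>\<omega>. max 0 (h (X \<omega>)) * Y \<omega> - max 0 (- h (X \<omega>)) * Y \<omega>)
      ((\<integral>\<omega>. max 0 (h (X \<omega>)) * ?e \<omega> \<partial>M) - (\<integral>\<omega>. max 0 (- h (X \<omega>)) * ?e \<omega> \<partial>M))"
    by (intro has_bochner_integral_diff nonneg i) auto
  moreover have "max 0 x * y - max 0 (- x) * y = x * y" for x y :: real
    by (auto simp: max_def)
  ultimately show ?thesis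
    using i by (simp flip: Bochner_Integration.integral_diff)
qed

section \<open>From convergence in probability to bias and mean squared error\<close>

text \<open>
  A form of Vitali's convergence theorem. For every \<open>\<delta> > 0\<close> and every \<open>K\<close>,
  $(Z-c)^2 \le \delta^2 + 2 Z^2 1_{\{Z^2 > K\}} + C\, 1_{\{|Z-c| > \delta\}}$ with \<open>C\<close> depending
  only on \<open>K\<close> and \<open>c\<close>: the second term is small in mean by uniform integrability, the third by
  convergence in probability.
\<close>

lemma asymptotically_uniformly_integrable_L2_convergence:
  assumes "prob_space M" and Z[measurable]: "\<And>n. Z n \<in> borel_measurable M"
    and lim: "converges_in_prob M Z c"
    and ui: "asymptotically_uniformly_integrable M (\<lambda>n \<omega>. (Z n \<omega>)\<^sup>2)"
  shows "(\<lambda>n. \<integral>\<^sup>+\<omega>. ennreal ((Z n \<omega> - c)\<^sup>2) \<partial>M) \<longlonglongrightarrow> 0"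
proof -
  interpret prob_space M by fact
  have "\<forall>\<^sub>F n in sequentially. (\<integral>\<^sup>+\<omega>. ennreal ((Z n \<omega> - c)\<^sup>2) \<partial>M) \<le> ennreal \<epsilon>" if "\<epsilon> > 0" for \<epsilon> :: real
  proof -
    have "\<epsilon> / 8 > 0" using that by simp
    then obtain K where K: "\<forall>\<^sub>F n in sequentially.
        (\<integral>\<^sup>+\<omega>. ennreal \<bar>(Z n \<omega>)\<^sup>2\<bar> * indicator {\<omega>. \<bar>(Z n \<omega>)\<^sup>2\<bar> > K} \<omega> \<partial>M) \<le> ennreal (\<epsilon> / 8)"
      using ui unfolding asymptotically_uniformly_integrable_def by blast
    \<comment> \<open>The shares of \<open>\<epsilon>\<close>: a quarter each from \<open>\<delta>\<^sup>2\<close>, twice the tail integral, and the event \<open>E n\<close>.\<close>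
    define C where "C = 2 * \<bar>K\<bar> + 2 * c\<^sup>2 + 1"
    have C: "C > 0" unfolding C_def by (intro add_nonneg_pos add_nonneg_nonneg) auto
    define \<delta> where "\<delta> = sqrt (\<epsilon> / 4)"
    have \<delta>: "\<delta> > 0" "\<delta>\<^sup>2 = \<epsilon> / 4" using that by (auto simp: \<delta>_def)
    define E where "E n = {\<omega> \<in> space M. \<bar>Z n \<omega> - c\<bar> > \<delta>}" for n
    have E[measurable]: "E n \<in> sets M" for n unfolding E_def by measurable
    have "(\<lambda>n. prob (E n)) \<longlonglongrightarrow> 0"
      using lim \<delta>(1) unfolding converges_in_prob_def E_def by blast
    then have "\<forall>\<^sub>F n in sequentially. prob (E n) < \<epsilon> / (4 * C)"
      using that C by (intro order_tendstoD(2)) auto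
    with K show ?thesis
    proof eventually_elim
      case (elim n)
      let ?J = "\<lambda>\<omega>. ennreal \<bar>(Z n \<omega>)\<^sup>2\<bar> * indicator {\<omega>. \<bar>(Z n \<omega>)\<^sup>2\<bar> > K} \<omega>"
      have "(\<integral>\<^sup>+\<omega>. ennreal ((Z n \<omega> - c)\<^sup>2) \<partial>M)
          \<le> (\<integral>\<^sup>+\<omega>. ennreal (\<delta>\<^sup>2) + 2 * ?J \<omega> + ennreal C * indicator (E n) \<omega> \<partial>M)"
      proof (rule nn_integral_mono)
        fix \<omega> assume \<omega>: "\<omega> \<in> space M"
        let ?z = "Z n \<omega>"
        have par: "(?z - c)\<^sup>2 \<le> 2 * ?z\<^sup>2 + 2 * c\<^sup>2"
          using zero_le_power2[of "?z + c"] by (simp add: power2_eq_square algebra_simps)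
        have "(?z - c)\<^sup>2 \<le> \<delta>\<^sup>2 + 2 * (?z\<^sup>2 * indicator {\<omega>. \<bar>(Z n \<omega>)\<^sup>2\<bar> > K} \<omega>) + C * indicator (E n) \<omega>"
        proof (cases "\<bar>?z - c\<bar> > \<delta>")
          case False
          then have "(?z - c)\<^sup>2 \<le> \<delta>\<^sup>2" using abs_le_square_iff[of "?z - c" \<delta>] \<delta>(1) by simp
          then show ?thesis using False by (auto simp: E_def indicator_def intro: add_increasing2)
        next
          case True
          show ?thesis
          proof (cases "?z\<^sup>2 > K")
            case True
            then show ?thesis using \<open>\<bar>?z - c\<bar> > \<delta>\<close> \<omega> par \<open>\<epsilon> > 0\<close>
              by (simp add: E_def C_def \<delta>(2))
          next
            case False
            then show ?thesis using \<open>\<bar>?z - c\<bar> > \<delta>\<close> \<omega> par \<open>\<epsilon> > 0\<close>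
              by (simp add: E_def C_def \<delta>(2))
          qed
        qed
        then have "ennreal ((?z - c)\<^sup>2)
            \<le> ennreal (\<delta>\<^sup>2 + 2 * (?z\<^sup>2 * indicator {\<omega>. \<bar>(Z n \<omega>)\<^sup>2\<bar> > K} \<omega>) + C * indicator (E n) \<omega>)"
          by (rule ennreal_leI)
        also have "\<dots> = ennreal (\<delta>\<^sup>2) + 2 * ?J \<omega> + ennreal C * indicator (E n) \<omega>"
          using C by (simp add: ennreal_plus ennreal_mult' ennreal_indicator)
        finally show "ennreal ((?z - c)\<^sup>2) \<le> ennreal (\<delta>\<^sup>2) + 2 * ?J \<omega> + ennreal C * indicator (E n) \<omega>" .
      qed
      also have "\<dots> = ennreal (\<delta>\<^sup>2) + 2 * (\<integral>\<^sup>+\<omega>. ?J \<omega> \<partial>M) + ennreal C * emeasure M (E n)"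
      proof -
        have [measurable]: "?J \<in> borel_measurable M"
        proof -
          have "?J = (\<lambda>\<omega>. ennreal ((Z n \<omega>)\<^sup>2) * indicator {x. x > K} ((Z n \<omega>)\<^sup>2))"
            by (auto simp: fun_eq_iff indicator_def)
          then show ?thesis by simp
        qed
        show ?thesis
          by (simp add: nn_integral_add nn_integral_cmult emeasure_space_1)
      qed
      also have "\<dots> \<le> ennreal (\<delta>\<^sup>2) + 2 * ennreal (\<epsilon> / 8) + ennreal C * ennreal (\<epsilon> / (4 * C))"
        using elim by (intro add_mono mult_left_mono) (auto simp: emeasure_eq_measure ennreal_leI)
      also have "\<dots> = ennreal (\<epsilon> / 4 + 2 * (\<epsilon> / 8) + C * (\<epsilon> / (4 * C)))"
        using that C \<delta>(2) by (simp add: ennreal_plus ennreal_mult'' del: times_divide_eq_right)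
      also have "\<dots> \<le> ennreal \<epsilon>"
        using that C by (intro ennreal_leI) simp
      finally show ?case .
    qed
  qed
  note bound = this
  show ?thesis
  proof (rule order_tendstoI)
    fix a :: ennreal assume "a < 0" then show "\<forall>\<^sub>F n in sequentially. a < (\<integral>\<^sup>+\<omega>. ennreal ((Z n \<omega> - c)\<^sup>2) \<partial>M)"
      by simp
  next
    fix a :: ennreal assume "0 < a"
    then obtain \<epsilon> :: ennreal where "0 < \<epsilon>" "\<epsilon> < a" using dense by blast
    then obtain e where e: "\<epsilon> = ennreal e" "e > 0" by (cases \<epsilon>) (auto simp: top_unique)
    from bound[OF e(2)] show "\<forall>\<^sub>F n in sequentially. (\<integral>\<^sup>+\<omega>. ennreal ((Z n \<omega> - c)\<^sup>2) \<partial>M) < a"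
      by eventually_elim (use \<open>\<epsilon> < a\<close> e in \<open>auto intro: order_le_less_trans\<close>)
  qed
qed

text \<open>
  Convergence in mean square to the constant \<open>c\<close> makes the random fluctuation disappear: only the
  deterministic error \<open>c - \<theta>\<close> survives in the first two moments of \<open>Z n - \<theta>\<close>, whence the mean
  squared error is asymptotically the squared bias.
\<close>

lemma bias_mse_of_L2_convergence:
  assumes "prob_space M" and Z[measurable]: "\<And>n. Z n \<in> borel_measurable M"
    and L2: "(\<lambda>n. \<integral>\<^sup>+\<omega>. ennreal ((Z n \<omega> - c)\<^sup>2) \<partial>M) \<longlonglongrightarrow> 0"
  shows "has_asymptotic_bias M Z \<theta> (c - \<theta>)" and "has_asymptotic_mse M Z \<theta> ((c - \<theta>)\<^sup>2)"
proof -
  interpret prob_space M by fact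
  let ?D = "\<lambda>n \<omega>. Z n \<omega> - c"
  have "\<forall>\<^sub>F n in sequentially. (\<integral>\<^sup>+\<omega>. ennreal ((?D n \<omega>)\<^sup>2) \<partial>M) < top"
    using L2 by (rule order_tendstoD) simp
  then have int2: "\<forall>\<^sub>F n in sequentially. integrable M (\<lambda>\<omega>. (?D n \<omega>)\<^sup>2)"
    by eventually_elim (auto intro!: integrableI_nonneg)
  then have int1: "\<forall>\<^sub>F n in sequentially. integrable M (?D n)"
    by eventually_elim (auto intro!: square_integrable_imp_integrable)
  have "(\<lambda>n. enn2real (\<integral>\<^sup>+\<omega>. ennreal ((?D n \<omega>)\<^sup>2) \<partial>M)) \<longlonglongrightarrow> enn2real 0"
    using L2 by (intro tendsto_enn2real) auto
  then have lim2: "(\<lambda>n. \<integral>\<omega>. (?D n \<omega>)\<^sup>2 \<partial>M) \<longlonglongrightarrow> 0"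
    by (simp add: integral_eq_nn_integral)
  have lim1: "(\<lambda>n. \<integral>\<omega>. ?D n \<omega> \<partial>M) \<longlonglongrightarrow> 0"
  proof (rule Lim_null_comparison)
    show "(\<lambda>n. sqrt (\<integral>\<omega>. (?D n \<omega>)\<^sup>2 \<partial>M)) \<longlonglongrightarrow> 0"
      using tendsto_real_sqrt[OF lim2] by simp
    show "\<forall>\<^sub>F n in sequentially. norm (\<integral>\<omega>. ?D n \<omega> \<partial>M) \<le> sqrt (\<integral>\<omega>. (?D n \<omega>)\<^sup>2 \<partial>M)"
      using int1 int2
    proof eventually_elim
      case (elim n)
      have "0 \<le> variance (?D n)" by (rule variance_positive)
      then have "(\<integral>\<omega>. ?D n \<omega> \<partial>M)\<^sup>2 \<le> (\<integral>\<omega>. (?D n \<omega>)\<^sup>2 \<partial>M)"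
        using variance_eq[OF elim] by simp
      then show ?case by (simp add: real_le_rsqrt)
    qed
  qed
  have split1: "Z n \<omega> - \<theta> = ?D n \<omega> + (c - \<theta>)" for n \<omega> by simp
  have split2: "(Z n \<omega> - \<theta>)\<^sup>2 = (?D n \<omega>)\<^sup>2 + 2 * (c - \<theta>) * ?D n \<omega> + (c - \<theta>)\<^sup>2" for n \<omega>
    by (simp add: power2_eq_square algebra_simps)
  show "has_asymptotic_bias M Z \<theta> (c - \<theta>)"
    unfolding has_asymptotic_bias_def
  proof
    show "\<forall>\<^sub>F n in sequentially. integrable M (\<lambda>\<omega>. Z n \<omega> - \<theta>)"
      unfolding split1 using int1 by eventually_elim (intro Bochner_Integration.integrable_add, auto)
    have "\<forall>\<^sub>F n in sequentially. (\<integral>\<omega>. ?D n \<omega> \<partial>M) + (c - \<theta>) = (\<integral>\<omega>. Z n \<omega> - \<theta> \<partial>M)"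
      using int1
    proof eventually_elim
      case (elim n)
      show ?case unfolding split1 by (subst Bochner_Integration.integral_add[OF elim]) (auto simp: prob_space)
    qed
    then show "(\<lambda>n. \<integral>\<omega>. Z n \<omega> - \<theta> \<partial>M) \<longlonglongrightarrow> c - \<theta>"
      by (rule Lim_transform_eventually[rotated]) (use tendsto_add[OF lim1 tendsto_const] in simp)
  qed
  show "has_asymptotic_mse M Z \<theta> ((c - \<theta>)\<^sup>2)"
    unfolding has_asymptotic_mse_def
  proof
    show "\<forall>\<^sub>F n in sequentially. integrable M (\<lambda>\<omega>. (Z n \<omega> - \<theta>)\<^sup>2)"
      unfolding split2 using int1 int2
      by eventually_elim (intro Bochner_Integration.integrable_add integrable_mult_right, auto)
    have "\<forall>\<^sub>F n in sequentially. (\<integral>\<omega>. (?D n \<omega>)\<^sup>2 \<partial>M) + 2 * (c - \<theta>) * (\<integral>\<omega>. ?D n \<omega> \<partial>M) + (c - \<theta>)\<^sup>2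
        = (\<integral>\<omega>. (Z n \<omega> - \<theta>)\<^sup>2 \<partial>M)"
      using int1 int2
    proof eventually_elim
      case (elim n)
      have "has_bochner_integral M (\<lambda>\<omega>. (?D n \<omega>)\<^sup>2 + 2 * (c - \<theta>) * ?D n \<omega> + (c - \<theta>)\<^sup>2)
          ((\<integral>\<omega>. (?D n \<omega>)\<^sup>2 \<partial>M) + 2 * (c - \<theta>) * (\<integral>\<omega>. ?D n \<omega> \<partial>M) + (\<integral>\<omega>. (c - \<theta>)\<^sup>2 \<partial>M))"
        using elim by (intro has_bochner_integral_add has_bochner_integral_mult_right
            has_bochner_integral_integrable integrable_const) auto
      from has_bochner_integral_integral_eq[OF this] show ?case
        unfolding split2 by (simp add: prob_space)
    qed
    moreover have "(\<lambda>n. (\<integral>\<omega>. (?D n \<omega>)\<^sup>2 \<partial>M) + 2 * (c - \<theta>) * (\<integral>\<omega>. ?D n \<omega> \<partial>M) + (c - \<theta>)\<^sup>2)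
        \<longlonglongrightarrow> 0 + 2 * (c - \<theta>) * 0 + (c - \<theta>)\<^sup>2"
      by (intro tendsto_intros lim1 lim2)
    ultimately show "(\<lambda>n. \<integral>\<omega>. (Z n \<omega> - \<theta>)\<^sup>2 \<partial>M) \<longlonglongrightarrow> (c - \<theta>)\<^sup>2"
      by (simp add: Lim_transform_eventually)
  qed
qed

section \<open>The limit of the naive estimator\<close>

lemma (in prob_space) indep_var_of_indep_pair:
  assumes [measurable]: "X \<in> borel_measurable M" "Y \<in> borel_measurable M" "U \<in> borel_measurable M"
    and indep: "indep_set (sets (vimage_algebra (space M) U borel))
      (sets (vimage_algebra (space M) (\<lambda>\<omega>. (X \<omega>, Y \<omega>)) (borel \<Otimes>\<^sub>M borel)))"
  shows "indep_var borel U borel (Y :: 'a \<Rightarrow> real)"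
proof -
  let ?XY = "vimage_algebra (space M) (\<lambda>\<omega>. (X \<omega>, Y \<omega>)) (borel \<Otimes>\<^sub>M borel)"
  have "(\<lambda>\<omega>. (X \<omega>, Y \<omega>)) \<in> measurable ?XY (borel \<Otimes>\<^sub>M borel)"
    by (rule measurable_vimage_algebra1) (auto simp: space_pair_measure)
  from measurable_compose[OF this measurable_snd] have "Y \<in> borel_measurable ?XY" by simp
  then have "Y -` A \<inter> space M \<in> sets ?XY" if "A \<in> sets borel" for A
    using measurable_sets[of Y ?XY borel A] that by simp
  then have "sigma_sets (space ?XY) {Y -` A \<inter> space M |A. A \<in> sets borel} \<subseteq> sets ?XY"
    by (intro sets.sigma_sets_subset) blast
  then have Y_sub: "sigma_sets (space M) {Y -` A \<inter> space M |A. A \<in> sets borel} \<subseteq> sets ?XY"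
    by simp
  have "indep_set (sigma_sets (space M) {U -` A \<inter> space M |A. A \<in> sets borel})
      (sigma_sets (space M) {Y -` A \<inter> space M |A. A \<in> sets borel})"
    unfolding indep_set_def
  proof (rule indep_sets_mono_sets[OF indep[unfolded indep_set_def]])
    fix i :: bool
    show "case_bool (sigma_sets (space M) {U -` A \<inter> space M |A. A \<in> sets borel})
        (sigma_sets (space M) {Y -` A \<inter> space M |A. A \<in> sets borel}) i
      \<subseteq> case_bool (sets (vimage_algebra (space M) U borel)) (sets ?XY) i"
      using Y_sub by (cases i) (simp_all only: bool.case sets_vimage_algebra order_refl)
  qed
  then show ?thesis
    unfolding indep_var_eq using assms(2,3) by blast
qed

text \<open>
  The two limiting estimating equations in terms of exponential moments. Conditioning on \<open>X\<close>
  replaces \<open>Y\<close> by its Poisson mean $e^{\beta_0 + \beta_1 X}$, and independence gives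
  $E[YW] = E[YX] + E[Y]\,E[U]$. Integrability of every term has to be established first, since only
  then can the integrals of differences be split.
\<close>

lemma (in prob_space) naive_limit_moment_equations:
  assumes X[measurable]: "X \<in> borel_measurable M" and Y[measurable]: "Y \<in> borel_measurable M"
    and U[measurable]: "U \<in> borel_measurable M"
    and model: "poisson_regression M \<beta>0 \<beta>1 X Y"
    and indep: "indep_var borel U borel Y" and intU: "integrable M U"
    and limit_eq: "limiting_equation M Y (\<lambda>\<omega>. X \<omega> + U \<omega>) b0 b1"
    and \<beta>1: "\<beta>1 \<in> interior (mgf_domain M X)"
    and b1: "b1 \<in> interior (mgf_domain M (\<lambda>\<omega>. X \<omega> + U \<omega>))"
  shows "exp \<beta>0 * mgf M X \<beta>1 = exp b0 * mgf M (\<lambda>\<omega>. X \<omega> + U \<omega>) b1"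
    and "exp \<beta>0 * (exp_moment M X 1 \<beta>1 + expectation U * mgf M X \<beta>1)
        = exp b0 * exp_moment M (\<lambda>\<omega>. X \<omega> + U \<omega>) 1 b1"
proof -
  let ?W = "\<lambda>\<omega>. X \<omega> + U \<omega>"
  have XY: "has_bochner_integral M (\<lambda>\<omega>. X \<omega> ^ k * Y \<omega>) (exp \<beta>0 * exp_moment M X k \<beta>1)" for k
  proof -
    have e: "X \<omega> ^ k * exp (\<beta>0 + \<beta>1 * X \<omega>) = exp \<beta>0 * (X \<omega> ^ k * exp (\<beta>1 * X \<omega>))" for \<omega>
      by (simp add: exp_add)
    have "integrable M (\<lambda>\<omega>. X \<omega> ^ k * exp (\<beta>0 + \<beta>1 * X \<omega>))"
      unfolding e by (intro integrable_mult_right integrable_exp_moment X \<beta>1)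
    from poisson_regression_integral[OF X Y model, of "\<lambda>x. x ^ k", OF _ this]
    show ?thesis unfolding e by (simp add: exp_moment_def)
  qed
  have WE: "has_bochner_integral M (\<lambda>\<omega>. ?W \<omega> ^ k * exp (b0 + b1 * ?W \<omega>)) (exp b0 * exp_moment M ?W k b1)" for k
  proof -
    have e: "?W \<omega> ^ k * exp (b0 + b1 * ?W \<omega>) = exp b0 * (?W \<omega> ^ k * exp (b1 * ?W \<omega>))" for \<omega>
      by (simp add: exp_add)
    show ?thesis
      unfolding e exp_moment_def
      by (intro has_bochner_integral_mult_right has_bochner_integral_integrable integrable_exp_moment b1)
        measurable
  qed
  have intY: "integrable M Y" and EY: "expectation Y = exp \<beta>0 * mgf M X \<beta>1"
    using XY[of 0] by (auto simp: has_bochner_integral_iff mgf_eq_exp_moment)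
  have "has_bochner_integral M (\<lambda>\<omega>. U \<omega> * Y \<omega>) (expectation U * expectation Y)"
    using indep_var_integrable[OF indep intU intY] indep_var_lebesgue_integral[OF indep intU intY]
    by (simp add: has_bochner_integral_iff)
  from has_bochner_integral_add[OF XY[of 1] this]
  have YW: "has_bochner_integral M (\<lambda>\<omega>. Y \<omega> * ?W \<omega>)
      (exp \<beta>0 * (exp_moment M X 1 \<beta>1 + expectation U * mgf M X \<beta>1))"
    unfolding EY by (simp add: algebra_simps)
  have "has_bochner_integral M (\<lambda>\<omega>. Y \<omega> - exp (b0 + b1 * ?W \<omega>)) (exp \<beta>0 * mgf M X \<beta>1 - exp b0 * mgf M ?W b1)"
    using has_bochner_integral_diff[OF XY[of 0] WE[of 0]] by (simp add: mgf_eq_exp_moment)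
  then show "exp \<beta>0 * mgf M X \<beta>1 = exp b0 * mgf M ?W b1"
    using limit_eq by (simp add: limiting_equation_def has_bochner_integral_iff)
  have "has_bochner_integral M (\<lambda>\<omega>. (Y \<omega> - exp (b0 + b1 * ?W \<omega>)) * ?W \<omega>)
      (exp \<beta>0 * (exp_moment M X 1 \<beta>1 + expectation U * mgf M X \<beta>1) - exp b0 * exp_moment M ?W 1 b1)"
    using has_bochner_integral_diff[OF YW WE[of 1]] by (simp add: algebra_simps)
  then show "exp \<beta>0 * (exp_moment M X 1 \<beta>1 + expectation U * mgf M X \<beta>1) = exp b0 * exp_moment M ?W 1 b1"
    using limit_eq by (simp add: limiting_equation_def has_bochner_integral_iff)
qed

text \<open>
  Dividing the second moment equation by the first eliminates both intercepts, and leaves a relation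
  between logarithmic derivatives of moment generating functions, which says that $G$ vanishes; the
  logarithm of the first equation gives the intercept.
\<close>

lemma (in prob_space) naive_limit_equations:
  assumes X: "X \<in> borel_measurable M" and Y: "Y \<in> borel_measurable M"
    and U: "U \<in> borel_measurable M"
    and model: "poisson_regression M \<beta>0 \<beta>1 X Y"
    and indep: "indep_var borel U borel Y" and intU: "integrable M U"
    and limit_eq: "limiting_equation M Y (\<lambda>\<omega>. X \<omega> + U \<omega>) b0 b1"
    and \<beta>1: "\<beta>1 \<in> interior (mgf_domain M X)"
    and b1: "b1 \<in> interior (mgf_domain M (\<lambda>\<omega>. X \<omega> + U \<omega>))"
  shows "bias_G M X U \<beta>1 b1 = 0"
    and "b0 - \<beta>0 = ln (mgf M X \<beta>1 / mgf M (\<lambda>\<omega>. X \<omega> + U \<omega>) b1)"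
proof -
  let ?W = "\<lambda>\<omega>. X \<omega> + U \<omega>"
  have W: "?W \<in> borel_measurable M" using X U by measurable
  note eqs = naive_limit_moment_equations[OF assms]
  have pos: "mgf M X \<beta>1 > 0" "mgf M ?W b1 > 0"
    using mgf_pos \<beta>1 b1 interior_subset by blast+
  \<comment> \<open>Expanding the fraction by \<open>exp b0\<close> exposes the right-hand sides of both moment equations.\<close>
  have "exp_moment M ?W 1 b1 / mgf M ?W b1
      = (exp b0 * exp_moment M ?W 1 b1) / (exp b0 * mgf M ?W b1)"
    by simp
  also have "\<dots> = exp_moment M X 1 \<beta>1 / mgf M X \<beta>1 + expectation U"
    unfolding eqs[symmetric] using pos by (simp add: field_simps)
  finally show "bias_G M X U \<beta>1 b1 = 0"
    unfolding bias_G_def cgf_deriv_eq[OF X \<beta>1] cgf_deriv_eq[OF W b1] by simp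
  have "\<beta>0 + ln (mgf M X \<beta>1) = b0 + ln (mgf M ?W b1)"
    using arg_cong[OF eqs(1), of ln] pos by (simp add: ln_mult)
  then show "b0 - \<beta>0 = ln (mgf M X \<beta>1 / mgf M ?W b1)"
    using pos by (simp add: ln_div)
qed

section \<open>Asymptotic bias and mean squared error of the naive estimator\<close>

theorem theorem1:
  fixes M :: "'a measure"
    and \<beta>0 \<beta>1 b0 b1 :: real
    and X Y U W :: "'a \<Rightarrow> real"
    and Xs Ys Us Ws :: "nat \<Rightarrow> 'a \<Rightarrow> real"
    and B0 B1 :: "nat \<Rightarrow> 'a \<Rightarrow> real"
  assumes prob: "prob_space M"
    and meas: "X \<in> borel_measurable M" "Y \<in> borel_measurable M" "U \<in> borel_measurable M"
    and model: "poisson_regression M \<beta>0 \<beta>1 X Y"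
    and W_def: "W = (\<lambda>\<omega>. X \<omega> + U \<omega>)"
    and indep: "prob_space.indep_set M
                  (sets (vimage_algebra (space M) U borel))
                  (sets (vimage_algebra (space M) (\<lambda>\<omega>. (X \<omega>, Y \<omega>)) (borel \<Otimes>\<^sub>M borel)))"
    and U_moments: "integrable M U" "integrable M (\<lambda>\<omega>. (U \<omega>)\<^sup>2)"
    and sample: "iid_copies M (borel \<Otimes>\<^sub>M borel \<Otimes>\<^sub>M borel)
                   (\<lambda>\<omega>. (Y \<omega>, X \<omega>, U \<omega>)) (\<lambda>i \<omega>. (Ys i \<omega>, Xs i \<omega>, Us i \<omega>))"
    and Ws_def: "Ws = (\<lambda>i \<omega>. Xs i \<omega> + Us i \<omega>)"
    and estimator: "naive_estimator M Ys Ws B0 B1"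
    and limit: "converges_in_prob M B0 b0" "converges_in_prob M B1 b1"
    and limit_eq: "limiting_equation M Y W b0 b1"
    and mgf_exists: "\<beta>1 \<in> mgf_domain M X" "b1 \<in> mgf_domain M X" "b1 \<in> mgf_domain M U"
    and cgf_derivs_exist: "\<beta>1 \<in> interior (mgf_domain M X)" "b1 \<in> interior (mgf_domain M W)"
    and G_zero: "\<exists>s \<in> interior (mgf_domain M X). \<exists>t \<in> interior (mgf_domain M W).
                   bias_G M X U s t = 0"
    and G_partial: "(deriv ^^ 2) (cgf M W) b1 \<noteq> 0"
    and unif_int: "asymptotically_uniformly_integrable M (\<lambda>n \<omega>. (B0 n \<omega>)\<^sup>2)"
                  "asymptotically_uniformly_integrable M (\<lambda>n \<omega>. (B1 n \<omega>)\<^sup>2)"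
  shows "deriv (\<lambda>t. bias_G M X U \<beta>1 t) b1 = (deriv ^^ 2) (cgf M W) b1 \<and>
         (\<exists>S T g. \<beta>1 \<in> S \<and> S \<subseteq> mgf_domain M X \<and> b1 \<in> T \<and> T \<subseteq> mgf_domain M W \<and>
           C1_implicit_function (bias_G M X U) S T g \<and> b1 = g \<beta>1 \<and>
           has_asymptotic_bias M B0 \<beta>0 (ln (mgf M X \<beta>1 / mgf M W (g \<beta>1))) \<and>
           has_asymptotic_bias M B1 \<beta>1 (g \<beta>1 - \<beta>1) \<and>
           has_asymptotic_mse M B0 \<beta>0 ((ln (mgf M X \<beta>1 / mgf M W (g \<beta>1)))\<^sup>2) \<and>
           has_asymptotic_mse M B1 \<beta>1 ((g \<beta>1 - \<beta>1)\<^sup>2))"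
proof -
  interpret prob_space M by (fact prob)
  let ?IX = "interior (mgf_domain M X)" and ?IW = "interior (mgf_domain M W)"
  have W: "W \<in> borel_measurable M" unfolding W_def using meas by measurable
  have indepUY: "indep_var borel U borel Y"
    using indep_var_of_indep_pair[OF meas indep] .
  note eqs = naive_limit_equations[OF meas model indepUY U_moments(1) limit_eq[unfolded W_def]
      cgf_derivs_exist[unfolded W_def], folded W_def]
  note X2 = DERIV_deriv_cgf[OF meas(1)] and W2 = DERIV_deriv_cgf[OF W]
  have G: "bias_G M X U = (\<lambda>s t. deriv (cgf M W) t - (expectation U + deriv (cgf M X) s))"
    unfolding bias_G_def W_def by (simp add: fun_eq_iff)
  have "((\<lambda>t. bias_G M X U \<beta>1 t) has_real_derivative (deriv ^^ 2) (cgf M W) b1) (at b1)"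
    unfolding G using W2[OF cgf_derivs_exist(2)] by (auto intro!: derivative_eq_intros)
  then have part: "deriv (\<lambda>t. bias_G M X U \<beta>1 t) b1 = (deriv ^^ 2) (cgf M W) b1"
    by (rule DERIV_imp_deriv)
  obtain S T g where ST: "\<beta>1 \<in> S" "S \<subseteq> ?IX" "b1 \<in> T" "T \<subseteq> ?IW" and g: "b1 = g \<beta>1"
    and C1: "C1_implicit_function (bias_G M X U) S T g"
    unfolding G
  proof (rule separable_implicit_function[OF open_interior cgf_derivs_exist(1) open_interior cgf_derivs_exist(2)])
    show "((\<lambda>s. expectation U + deriv (cgf M X) s) has_real_derivative (deriv ^^ 2) (cgf M X) s) (at s)"
      if "s \<in> ?IX" for s
      using X2[OF that] by (auto intro!: derivative_eq_intros)
    show "continuous_on ?IX ((deriv ^^ 2) (cgf M X))"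
      by (intro continuous_at_imp_continuous_on ballI isCont_cgf_second meas)
    show "(deriv (cgf M W) has_real_derivative (deriv ^^ 2) (cgf M W) t) (at t)" if "t \<in> ?IW" for t
      using W2[OF that] .
    show "continuous_on ?IW ((deriv ^^ 2) (cgf M W))"
      by (intro continuous_at_imp_continuous_on ballI isCont_cgf_second W)
    show "(deriv ^^ 2) (cgf M W) b1 \<noteq> 0" by (fact G_partial)
    show "deriv (cgf M W) b1 = expectation U + deriv (cgf M X) \<beta>1"
      using eqs(1) by (simp add: G)
  qed
  have B: "B0 n \<in> borel_measurable M" "B1 n \<in> borel_measurable M" for n
    using estimator by (auto simp: naive_estimator_def)
  note L0 = asymptotically_uniformly_integrable_L2_convergence[OF prob B(1) limit(1) unif_int(1)]
  note L1 = asymptotically_uniformly_integrable_L2_convergence[OF prob B(2) limit(2) unif_int(2)]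
  note bias_mse0 = bias_mse_of_L2_convergence[OF prob B(1) L0, of \<beta>0, unfolded eqs(2) g]
  note bias_mse1 = bias_mse_of_L2_convergence[OF prob B(2) L1, of \<beta>1, unfolded g]
  show ?thesis
  proof (intro conjI exI)
    show "S \<subseteq> mgf_domain M X" "T \<subseteq> mgf_domain M W"
      using ST interior_subset by blast+
  qed (fact part ST g C1 bias_mse0 bias_mse1)+
qed

end
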